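(* Let $q=p^n\ge 3$ with $p$ prime and $n\in\mathbb{Z}^+$, and let $\chi$ be a generator of the group $\widehat{\mathbb{F}_q^{\times}}$ of multiplicative characters of $\mathbb{F}_q$. Then $$\det\left[J_q(\chi^i,\chi^j)\right]_{1\le i,j\le q-2}=(q-1)^{q-3}.$$
   Context: Multiplicative characters $\psi:\mathbb{F}_q^\times\to\mathbb{C}^\times$ are extended to $\mathbb{F}_q$ by $\psi(0)=0$. The Jacobi sum is $J_q(\chi^i,\chi^j):=\sum_{x\in\mathbb{F}_q}\chi^i(x)\chi^j(1-x)$. *)

theory Defs
  imports
    "HOL-Algebra.Multiplicative_Group"
    "HOL-Algebra.Generated_Groups"
    "Jordan_Normal_Form.Determinant"
begin

definition complex_units :: "complex monoid" where
  "complex_units = \<lparr>carrier = UNIV - {0}, monoid.mult = (*), one = 1\<rparr>"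

text \<open>
  The character group of \<open>G\<close>: homomorphisms into the nonzero complex numbers with pointwise
  multiplication. Characters are required to be extensional (\<open>undefined\<close> off the carrier),
  so that two characters agreeing on \<open>carrier G\<close> are equal as HOL functions.
\<close>

definition character_group :: "('a, 'b) monoid_scheme \<Rightarrow> ('a \<Rightarrow> complex) monoid" where
  "character_group G =
     \<lparr>carrier = hom G complex_units \<inter> extensional (carrier G),
      monoid.mult = (\<lambda>\<psi> \<phi>. \<lambda>x\<in>carrier G. \<psi> x * \<phi> x),
      one = (\<lambda>x\<in>carrier G. 1)\<rparr>"

lemma comm_group_character_group:
  assumes "group G"
  shows "comm_group (character_group G)"
proof (rule comm_groupI)
  interpret group G by fact
  fix \<psi> assume \<psi>: "\<psi> \<in> carrier (character_group G)"
  have nz: "\<psi> x \<noteq> 0" if "x \<in> carrier G" for x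
    using \<psi> that by (auto simp: character_group_def complex_units_def hom_def)
  have "(\<lambda>x\<in>carrier G. inverse (\<psi> x)) \<in> carrier (character_group G)"
    using \<psi> nz by (auto simp: character_group_def complex_units_def hom_def)
  moreover have "(\<lambda>x\<in>carrier G. inverse (\<psi> x)) \<otimes>\<^bsub>character_group G\<^esub> \<psi> =
      \<one>\<^bsub>character_group G\<^esub>"
    using nz by (auto simp: character_group_def restrict_def)
  ultimately show "\<exists>\<phi>\<in>carrier (character_group G).
      \<phi> \<otimes>\<^bsub>character_group G\<^esub> \<psi> = \<one>\<^bsub>character_group G\<^esub>"
    by blast
next
  interpret group G by fact
  fix \<psi> \<phi> assume "\<psi> \<in> carrier (character_group G)" "\<phi> \<in> carrier (character_group G)"
  then show "\<psi> \<otimes>\<^bsub>character_group G\<^esub> \<phi> \<in> carrier (character_group G)"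
    by (auto simp: character_group_def complex_units_def hom_def Pi_iff)
next
  interpret group G by fact
  show "\<one>\<^bsub>character_group G\<^esub> \<in> carrier (character_group G)"
    by (auto simp: character_group_def complex_units_def hom_def)
next
  fix \<psi> assume "\<psi> \<in> carrier (character_group G)"
  then show "\<one>\<^bsub>character_group G\<^esub> \<otimes>\<^bsub>character_group G\<^esub> \<psi> = \<psi>"
    by (auto simp: character_group_def restrict_def extensional_def)
qed (auto simp: character_group_def restrict_def mult_ac)

definition zero_extension :: "('a, 'b) ring_scheme \<Rightarrow> ('a \<Rightarrow> complex) \<Rightarrow> 'a \<Rightarrow> complex" where
  "zero_extension F \<psi> x = (if x \<in> carrier (mult_of F) then \<psi> x else 0)"

definition jacobi_sum ::
    "('a, 'b) ring_scheme \<Rightarrow> ('a \<Rightarrow> complex) \<Rightarrow> ('a \<Rightarrow> complex) \<Rightarrow> complex" where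
  "jacobi_sum F \<psi> \<phi> =
     (\<Sum>x\<in>carrier F. zero_extension F \<psi> x * zero_extension F \<phi> (\<one>\<^bsub>F\<^esub> \<ominus>\<^bsub>F\<^esub> x))"

end

theory Submission
  imports Defs
begin

text \<open>
  Enumerate \<open>F - {0, 1}\<close> as \<open>e 0, \<dots>, e (q - 3)\<close> so that \<open>x \<mapsto> 1 - x\<close> becomes reversal of the
  index; this is possible because that involution has at most one fixed point. With
  \<open>A = [\<chi>\<^sup>i (e k)]\<close> and \<open>R\<close> the reversal permutation matrix, the Jacobi matrix is
  \<open>A (A R)\<^sup>T\<close>, so its determinant equals \<open>det (A A\<^sup>T R)\<close> and no sign has to be computed.
  By orthogonality \<open>A A\<^sup>T R = (q - 1) I - O\<close> with \<open>O\<close> the all-ones matrix.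
\<close>

section \<open>Linear algebra and combinatorics: a determinant and an enumeration\<close>

text \<open>Every row sums to \<open>c - of_nat (Suc k)\<close>, so the all-ones vector is an
  eigenvector. Completing it to the unitriangular matrix \<open>P\<close> makes the matrix similar
  to a triangular one. The similarity is stated as \<open>D * P = P * T\<close>, so \<open>P\<close>
  is never inverted and \<open>det P = 1\<close> drops out over any commutative ring.\<close>

lemma det_scalar_minus_ones:
  fixes c :: "'a :: comm_ring_1"
  shows "det (mat (Suc k) (Suc k) (\<lambda>(i, j). (if i = j then c else 0) - 1)) =
    (c - of_nat (Suc k)) * c ^ k"
proof -
  let ?n = "Suc k"
  define D where "D = mat ?n ?n (\<lambda>(i, j). (if i = j then c else 0) - 1)"
  \<comment> \<open>\<open>P\<close> adds all columns to column 0, so that the first column of \<open>D * P\<close> is constant.\<close>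
  define P :: "'a mat" where "P = mat ?n ?n (\<lambda>(i, j). if j = 0 \<or> i = j then 1 else 0)"
  \<comment> \<open>\<open>T\<close> is \<open>D * P\<close> with row 0 subtracted from every other
    row; multiplying by \<open>P\<close> on the left undoes this.\<close>
  define T where "T = mat ?n ?n (\<lambda>(i, j).
    if i = 0 then (if j = 0 then c - of_nat ?n else - 1) else if i = j then c else 0)"
  have carr: "D \<in> carrier_mat ?n ?n" "P \<in> carrier_mat ?n ?n" "T \<in> carrier_mat ?n ?n"
    by (simp_all add: D_def P_def T_def)
  have "D * P = P * T"
  proof (rule eq_matI)
    fix i j assume "i < dim_row (P * T)" "j < dim_col (P * T)"
    then have ij: "i < ?n" "j < ?n" by (simp_all add: P_def T_def)
    have "(D * P) $$ (i, j) =
        (\<Sum>l = 0..<?n. ((if i = l then c else 0) - 1) * (if j = 0 \<or> l = j then 1 else 0))"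
      using ij by (auto simp: D_def P_def scalar_prod_def intro!: sum.cong)
    also have "\<dots> = (if j = 0 then c - of_nat ?n else (if i = j then c else 0) - 1)"
    proof (cases "j = 0")
      case True
      then show ?thesis using ij by (simp add: sum_subtractf del: sum.op_ivl_Suc)
    next
      case False
      then have "(\<Sum>l = 0..<?n. ((if i = l then c else 0) - 1) * (if j = 0 \<or> l = j then 1 else 0)) =
        (\<Sum>l = 0..<?n. if l = j then (if i = l then c else 0) - 1 else 0)"
        by (intro sum.cong) auto
      then show ?thesis using False ij by (simp del: sum.op_ivl_Suc)
    qed
    also have "\<dots> = (\<Sum>l = 0..<?n. (if l = 0 \<or> i = l then 1 else 0) * T $$ (l, j))"
    proof -
      \<comment> \<open>Row \<open>i\<close> of \<open>P\<close> is supported on columns 0 and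
        \<open>i\<close>. These coincide when \<open>i = 0\<close>, so the term \<open>l = 0\<close>
        is split off before the second contribution is read off.\<close>
      have "(\<Sum>l = 0..<?n. (if l = 0 \<or> i = l then 1 else 0) * T $$ (l, j)) =
          T $$ (0, j) + (\<Sum>l = 0..<k. if i = Suc l then T $$ (Suc l, j) else 0)"
        by (subst sum.atLeast0_lessThan_Suc_shift)
          (auto simp del: sum.op_ivl_Suc intro!: sum.cong)
      also have "(\<Sum>l = 0..<k. if i = Suc l then T $$ (Suc l, j) else 0) =
          (if i = 0 then 0 else T $$ (i, j))"
        using ij by (cases i) simp_all
      finally show ?thesis using ij by (auto simp: T_def)
    qed
    also have "\<dots> = (P * T) $$ (i, j)"
      using ij carr by (auto simp: P_def scalar_prod_def simp del: sum.op_ivl_Suc intro!: sum.cong)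
    finally show "(D * P) $$ (i, j) = (P * T) $$ (i, j)" .
  qed (use carr in auto)
  moreover have "det P = 1"
    by (subst det_lower_triangular[OF _ carr(2)]) (auto simp: prod_list_diag_prod P_def)
  moreover have "det T = (c - of_nat ?n) * c ^ k"
  proof -
    have "upper_triangular T" by (auto simp: T_def)
    then have "det T = (\<Prod>i = 0..<?n. T $$ (i, i))"
      using det_upper_triangular[OF _ carr(3)] by (simp add: prod_list_diag_prod T_def)
    also have "\<dots> = (c - of_nat ?n) * (\<Prod>i = 0..<k. c)"
      by (subst prod.atLeast0_lessThan_Suc_shift) (simp add: T_def)
    finally show ?thesis by simp
  qed
  ultimately show ?thesis
    using det_mult[OF carr(1,2)] det_mult[OF carr(2,3)] by (simp add: D_def)
qed

text \<open>Induction on \<open>S\<close>: an orbit \<open>{a, s a}\<close> with two elements is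
  removed and placed at the two ends of the enumeration of the rest. When no such orbit is left, all
  points are fixed, hence there is at most one, and it sits in the middle.\<close>

lemma involution_symmetric_enumeration:
  assumes "finite S" "\<And>x. x \<in> S \<Longrightarrow> s x \<in> S" "\<And>x. x \<in> S \<Longrightarrow> s (s x) = x"
    and "\<And>x y. x \<in> S \<Longrightarrow> y \<in> S \<Longrightarrow> s x = x \<Longrightarrow> s y = y \<Longrightarrow> x = y"
  shows "\<exists>e. bij_betw e {..<card S} S \<and> (\<forall>k < card S. e (card S - 1 - k) = s (e k))"
  using assms
proof (induction S rule: finite_psubset_induct)
  case (psubset S)
  show ?case
  proof (cases "\<exists>a\<in>S. s a \<noteq> a")
    case False
    then have "\<And>x y. x \<in> S \<Longrightarrow> y \<in> S \<Longrightarrow> x = y" using psubset.prems(3) by blast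
    then consider "S = {}" | a where "S = {a}" by blast
    then show ?thesis
    proof cases
      case 2
      then show ?thesis using False by (intro exI[of _ "\<lambda>_. a"]) (auto simp: bij_betw_def inj_on_def)
    qed (simp add: bij_betw_def)
  next
    case True
    then obtain a where a: "a \<in> S" "s a \<noteq> a" by blast
    define S' where "S' = S - {a, s a}"
    have S': "S' \<subset> S" using a by (auto simp: S'_def)
    have S_eq: "S = insert a (insert (s a) S')" "a \<notin> S'" "s a \<notin> S'"
      using a psubset.prems(1) by (auto simp: S'_def)
    have "\<exists>e. bij_betw e {..<card S'} S' \<and> (\<forall>k < card S'. e (card S' - 1 - k) = s (e k))"
    proof (rule psubset.IH[OF S'])
      show "s x \<in> S'" if "x \<in> S'" for x
        using that psubset.prems(1,2) a by (metis DiffD1 DiffD2 DiffI S'_def insertCI insertE singletonD)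
    next
      show "x = y" if "x \<in> S'" "y \<in> S'" "s x = x" "s y = y" for x y
        using that S' psubset.prems(3) by blast
    qed (use S' psubset.prems(2) in blast)
    then obtain e where e: "bij_betw e {..<card S'} S'"
      "\<And>k. k < card S' \<Longrightarrow> e (card S' - 1 - k) = s (e k)" by blast
    have fin: "finite S'" using psubset.hyps S' finite_subset by blast
    have card: "card S = Suc (Suc (card S'))" using S_eq a fin by simp
    \<comment> \<open>The old enumeration is shifted by one between the new ends, so reversal of the
      longer range restricts to reversal of the shorter one.\<close>
    define e' where "e' k = (if k = 0 then a else if k = Suc (card S') then s a else e (k - 1))" for k
    have "bij_betw e' (insert 0 (insert (Suc (card S')) (Suc ` {..<card S'}))) S"
    proof -
      have "bij_betw e' (Suc ` {..<card S'}) S'"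
      proof -
        have "bij_betw (e' \<circ> Suc) {..<card S'} S'"
          using e(1) by (subst bij_betw_cong[where g = e]) (auto simp: e'_def)
        then show ?thesis by (simp add: bij_betw_comp_iff2 bij_betw_def inj_on_def image_comp)
      qed
      then have "bij_betw e' (insert (Suc (card S')) (Suc ` {..<card S'})) (insert (s a) S')"
        using notIn_Un_bij_betw[of "Suc (card S')" "Suc ` {..<card S'}" e' S'] S_eq
        by (simp add: e'_def image_iff)
      then show ?thesis
        using notIn_Un_bij_betw[of 0 "insert (Suc (card S')) (Suc ` {..<card S'})" e' "insert (s a) S'"]
          S_eq a by (simp add: e'_def image_iff)
    qed
    moreover have "insert 0 (insert (Suc (card S')) (Suc ` {..<card S'})) = {..<card S}"
      unfolding card by (simp add: lessThan_Suc_eq_insert_0[of "Suc (card S')"]) (simp add: lessThan_Suc)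
    moreover have "e' (card S - 1 - k) = s (e' k)" if "k < card S" for k
    proof -
      have "k = 0 \<or> k = Suc (card S') \<or> (\<exists>l < card S'. k = Suc l)"
        using that card by (cases k) auto
      then consider "k = 0" | "k = Suc (card S')" | l where "k = Suc l" "l < card S'" by blast
      then show ?thesis
      proof cases
        case 3
        then show ?thesis using e(2)[of l] by (auto simp: e'_def card Suc_diff_Suc)
      qed (use a psubset.prems(2) in \<open>auto simp: e'_def card\<close>)
    qed
    ultimately show ?thesis by auto
  qed
qed

section \<open>Complex characters of groups and their orthogonality\<close>

lemma carrier_character_group_iff:
  "\<psi> \<in> carrier (character_group G) \<longleftrightarrow> \<psi> \<in> extensional (carrier G) \<and>
    (\<forall>x\<in>carrier G. \<psi> x \<noteq> 0) \<and>
    (\<forall>x\<in>carrier G. \<forall>y\<in>carrier G. \<psi> (x \<otimes>\<^bsub>G\<^esub> y) = \<psi> x * \<psi> y)"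
  by (auto simp: character_group_def complex_units_def hom_def)

lemma character_one:
  assumes "group G" "\<psi> \<in> carrier (character_group G)"
  shows "\<psi> \<one>\<^bsub>G\<^esub> = 1"
proof -
  interpret group G by fact
  have "\<psi> (\<one>\<^bsub>G\<^esub> \<otimes>\<^bsub>G\<^esub> \<one>\<^bsub>G\<^esub>) = \<psi> \<one>\<^bsub>G\<^esub> * \<psi> \<one>\<^bsub>G\<^esub>" "\<psi> \<one>\<^bsub>G\<^esub> \<noteq> 0"
    using assms(2) one_closed unfolding carrier_character_group_iff by blast+
  then show ?thesis by simp
qed

lemma character_group_nat_pow:
  fixes k :: nat
  assumes "group G"
  shows "\<psi> [^]\<^bsub>character_group G\<^esub> k = (\<lambda>x\<in>carrier G. \<psi> x ^ k)"
proof -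
  interpret C: comm_group "character_group G" by (rule comm_group_character_group[OF assms])
  show ?thesis
    by (induction k) (auto simp: character_group_def restrict_def mult.commute)
qed

text \<open>Translation by \<open>a\<close> permutes the group and multiplies the sum by
  \<open>\<psi> a\<close>, which differs from 1.\<close>

lemma sum_nontrivial_character:
  assumes "group G" "finite (carrier G)"
    and \<psi>: "\<psi> \<in> carrier (character_group G)" and a: "a \<in> carrier G" "\<psi> a \<noteq> 1"
  shows "(\<Sum>x\<in>carrier G. \<psi> x) = 0"
proof -
  interpret group G by fact
  have "bij_betw (\<lambda>x. a \<otimes>\<^bsub>G\<^esub> x) (carrier G) (carrier G)"
    using a by (intro bij_betwI[where g = "\<lambda>x. inv\<^bsub>G\<^esub> a \<otimes>\<^bsub>G\<^esub> x"]) (auto simp flip: m_assoc)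
  then have "(\<Sum>x\<in>carrier G. \<psi> x) = (\<Sum>x\<in>carrier G. \<psi> (a \<otimes>\<^bsub>G\<^esub> x))"
    by (rule sum.reindex_bij_betw[symmetric])
  also have "\<dots> = \<psi> a * (\<Sum>x\<in>carrier G. \<psi> x)"
    using \<psi> a by (simp add: carrier_character_group_iff sum_distrib_left)
  finally show ?thesis using a by simp
qed

text \<open>The exponent may be reduced modulo \<open>N\<close>, and the powers with exponents below
  \<open>N\<close> are the distinct \<open>N\<close>-th roots of unity.\<close>

lemma cis_primitive_root:
  assumes "N > 0" "cis (2 * pi / real N) ^ d = 1"
  shows "N dvd d"
proof -
  let ?\<omega> = "cis (2 * pi / real N)"
  have pow: "?\<omega> ^ k = cis (2 * pi * real k / real N)" for k
    by (simp add: DeMoivre mult_ac)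
  have "?\<omega> ^ N = 1" using assms by (simp add: pow)
  then have "?\<omega> ^ (d mod N) = ?\<omega> ^ d"
    by (metis div_mult_mod_eq mult.commute mult_1 power_add power_mult power_one)
  then have eq: "cis (2 * pi * real (d mod N) / real N) = cis (2 * pi * real 0 / real N)"
    using assms(2) by (simp only: pow) simp
  have inj: "inj_on (\<lambda>k. cis (2 * pi * real k / real N)) {..<N}"
    using bij_betw_roots_unity[OF assms(1)] by (simp add: bij_betw_def)
  have "d mod N = 0"
    by (rule inj_onD[OF inj eq]) (use assms(1) in simp_all)
  then show ?thesis by blast
qed

text \<open>A cyclic group of order \<open>N\<close> has a character with values of exact order \<open>N\<close>,
  and every exponent killing a generator of the character group kills that character as well.\<close>

lemma character_group_generator_exponent:
  assumes "group G" "finite (carrier G)"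
    and g: "g \<in> carrier G" "carrier G = {g [^]\<^bsub>G\<^esub> i | i :: nat. i \<in> UNIV}"
    and \<chi>: "\<chi> \<in> carrier (character_group G)"
    and gen: "generate (character_group G) {\<chi>} = carrier (character_group G)"
    and d: "\<And>x. x \<in> carrier G \<Longrightarrow> \<chi> x ^ d = 1"
  shows "Coset.order G dvd d"
proof -
  interpret group G by fact
  interpret C: comm_group "character_group G" by (rule comm_group_character_group) fact
  define N where "N = Coset.order G"
  have N: "N > 0" using assms(2) by (auto simp: N_def order_gt_0_iff_finite)
  have ord: "group.ord G g = N"
    using generate_pow_card[OF g(1)] generate_pow_on_finite_carrier[OF assms(2) g(1)] g(2)
    by (simp add: N_def Coset.order_def)
  define \<omega> where "\<omega> = cis (2 * pi / real N)"
  \<comment> \<open>The exponent chosen is a discrete logarithm to base \<open>g\<close>. It is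
    determined only modulo the order \<open>N\<close> of \<open>g\<close>, which is harmless because
    \<open>\<omega> ^ N = 1\<close>.\<close>
  define \<psi> where "\<psi> = (\<lambda>x\<in>carrier G. \<omega> ^ (SOME i. x = g [^]\<^bsub>G\<^esub> (i :: nat)))"
  have \<omega>N: "\<omega> ^ N = 1" using N by (simp add: \<omega>_def DeMoivre)
  have \<psi>_pow: "\<psi> (g [^]\<^bsub>G\<^esub> i) = \<omega> ^ i" for i :: nat
  proof -
    define j where "j = (SOME j. g [^]\<^bsub>G\<^esub> i = g [^]\<^bsub>G\<^esub> (j :: nat))"
    have "g [^]\<^bsub>G\<^esub> i = g [^]\<^bsub>G\<^esub> j" unfolding j_def by (rule someI[of _ i]) simp
    then have "int N dvd int i - int j"
      using int_pow_eq[OF g(1), of "int j" "int i"] ord by (simp add: int_pow_int)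
    then have "i mod N = j mod N" by (metis of_nat_eq_iff of_nat_mod mod_eq_dvd_iff)
    then have "\<omega> ^ i = \<omega> ^ j"
      by (metis \<omega>N div_mult_mod_eq mult.commute mult_1 power_add power_mult power_one)
    then show ?thesis using nat_pow_closed[OF g(1), of i] unfolding \<psi>_def j_def by simp
  qed
  have "\<psi> \<in> carrier (character_group G)"
  proof -
    have "\<psi> (x \<otimes>\<^bsub>G\<^esub> y) = \<psi> x * \<psi> y" if xy: "x \<in> carrier G" "y \<in> carrier G" for x y
    proof -
      obtain i j :: nat where "x = g [^]\<^bsub>G\<^esub> i" "y = g [^]\<^bsub>G\<^esub> j" using xy g(2) by blast
      then show ?thesis using g(1) by (simp add: nat_pow_mult \<psi>_pow power_add)
    qed
    then show ?thesis by (auto simp: carrier_character_group_iff \<psi>_def \<omega>_def)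
  qed
  \<comment> \<open>As a power of \<open>\<chi>\<close>, the character \<open>\<psi>\<close> is also
    killed by \<open>d\<close>; evaluation at \<open>g\<close> then forces
    \<open>\<omega> ^ d = 1\<close>.\<close>
  then obtain k :: int where k: "\<psi> = \<chi> [^]\<^bsub>character_group G\<^esub> k"
    using gen C.generate_pow[OF \<chi>] by blast
  have one: "\<one>\<^bsub>character_group G\<^esub> = (\<lambda>x\<in>carrier G. 1)" by (simp add: character_group_def)
  have "\<chi> [^]\<^bsub>character_group G\<^esub> d = \<one>\<^bsub>character_group G\<^esub>"
    unfolding character_group_nat_pow[OF assms(1)] one using d by (intro restrict_ext)
  then have "\<psi> [^]\<^bsub>character_group G\<^esub> d = \<one>\<^bsub>character_group G\<^esub>"
    unfolding k using \<chi> by (metis int_pow_int C.int_pow_one C.int_pow_pow mult.commute)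
  then have "\<psi> g ^ d = 1"
    using g(1) unfolding character_group_nat_pow[OF assms(1)] one
    by (auto dest!: fun_cong[of _ _ g])
  then have "\<omega> ^ d = 1" using \<psi>_pow[of 1] g(1) by simp
  then show ?thesis using cis_primitive_root[OF N] by (simp add: \<omega>_def N_def)
qed

section \<open>Power sums of a generating character and Jacobi sums over a finite field\<close>

text \<open>If the \<open>d\<close>-th power of \<open>\<chi>\<close> is trivial, all terms are 1,
  and cyclicity of the multiplicative group gives the divisibility. Otherwise orthogonality makes
  the sum vanish, and Lagrange's theorem rules the divisibility out.\<close>

lemma (in field) sum_generator_power:
  assumes fin: "finite (carrier R)"
    and \<chi>: "\<chi> \<in> carrier (character_group (mult_of R))"
    and gen: "generate (character_group (mult_of R)) {\<chi>} = carrier (character_group (mult_of R))"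
  shows "(\<Sum>x\<in>carrier (mult_of R). \<chi> x ^ d) =
    (if Coset.order R - 1 dvd d then of_nat (Coset.order R - 1) else 0)"
proof -
  interpret M: group "mult_of R" by (rule field_mult_group)
  interpret C: comm_group "character_group (mult_of R)"
    by (rule comm_group_character_group) (rule M.group_axioms)
  define N where "N = Coset.order R - 1"
  have N: "N = Coset.order (mult_of R)" using order_mult_of[OF fin] by (simp add: N_def)
  have fin': "finite (carrier (mult_of R))" using fin by simp
  have one: "\<chi> \<one> = 1" using character_one[OF M.group_axioms \<chi>] by simp
  show ?thesis
  proof (cases "\<forall>x\<in>carrier (mult_of R). \<chi> x ^ d = 1")
    case True
    obtain g where g: "g \<in> carrier (mult_of R)"
      "carrier (mult_of R) = {g [^]\<^bsub>R\<^esub> i | i :: nat. i \<in> UNIV}"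
      using finite_field_mult_group_has_gen[OF fin] by blast
    have "Coset.order (mult_of R) dvd d"
      by (rule character_group_generator_exponent[OF M.group_axioms fin' g(1) _ \<chi> gen])
        (use g(2) True in \<open>auto simp: nat_pow_mult_of\<close>)
    then show ?thesis using True by (simp add: N[symmetric] N_def[symmetric]) (simp add: N Coset.order_def)
  next
    case False
    then obtain a where a: "a \<in> carrier (mult_of R)" "\<chi> a ^ d \<noteq> 1" by blast
    have "\<not> N dvd d"
    proof
      assume "N dvd d"
      then have "a [^]\<^bsub>mult_of R\<^esub> d = \<one>\<^bsub>mult_of R\<^esub>"
        using M.pow_order_eq_1[OF a(1)] N a(1)
        by (metis dvd_def M.nat_pow_pow M.nat_pow_one)
      moreover have "\<chi> (a [^]\<^bsub>mult_of R\<^esub> k) = \<chi> a ^ k" for k :: nat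
        using \<chi> a(1) M.nat_pow_closed[OF a(1)] one
        by (induction k) (auto simp: carrier_character_group_iff mult.commute)
      ultimately show False using a(2) one by (metis one_mult_of)
    qed
    moreover have "(\<Sum>x\<in>carrier (mult_of R). (\<chi> [^]\<^bsub>character_group (mult_of R)\<^esub> d) x) = 0"
      by (rule sum_nontrivial_character[OF M.group_axioms fin' C.nat_pow_closed[OF \<chi>] a(1)])
        (use a in \<open>simp add: character_group_nat_pow[OF M.group_axioms]\<close>)
    ultimately show ?thesis
      by (simp add: character_group_nat_pow[OF M.group_axioms] N_def)
  qed
qed

text \<open>The extension by zero is applied after taking powers, so the terms at 0 and 1 vanish for
  every exponent, including 0.\<close>

lemma (in field) jacobi_sum_powers:
  assumes "finite (carrier R)"
  shows "jacobi_sum R (\<chi> [^]\<^bsub>character_group (mult_of R)\<^esub> (a :: nat))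
      (\<chi> [^]\<^bsub>character_group (mult_of R)\<^esub> (b :: nat)) =
    (\<Sum>x\<in>carrier R - {\<zero>, \<one>}. \<chi> x ^ a * \<chi> (\<one> \<ominus> x) ^ b)"
proof -
  have "\<one> \<ominus> x = \<zero> \<longleftrightarrow> x = \<one>" if "x \<in> carrier R" for x
    using that by (metis one_closed r_right_minus_eq)
  then show ?thesis
    unfolding jacobi_sum_def character_group_nat_pow[OF field_mult_group]
    by (intro sum.mono_neutral_cong_right) (use assms in \<open>auto simp: zero_extension_def\<close>)
qed

text \<open>A fixed point satisfies \<open>x \<oplus> x = \<one>\<close>. Expanding
  \<open>x \<otimes> (y \<oplus> y) = (x \<oplus> x) \<otimes> y\<close> compares two of them
  uniformly in the characteristic.\<close>

lemma (in field) one_minus_fixed_point_unique: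
  assumes "x \<in> carrier R" "y \<in> carrier R" "\<one> \<ominus> x = x" "\<one> \<ominus> y = y"
  shows "x = y"
proof -
  have xx: "x \<oplus> x = \<one>" and yy: "y \<oplus> y = \<one>"
    using assms by (metis a_minus_def a_assoc a_inv_closed l_neg one_closed r_zero)+
  have "x = x \<otimes> (y \<oplus> y)" using yy assms by simp
  also have "\<dots> = (x \<oplus> x) \<otimes> y" using assms by (simp add: l_distr r_distr)
  finally show ?thesis using xx assms by simp
qed

section \<open>Factorisation of the Jacobi matrix and evaluation of its determinant\<close>

theorem theorem1p2:
  fixes p n q :: nat
    and F :: "('a, 'b) ring_scheme"
    and \<chi> :: "'a \<Rightarrow> complex"
  assumes "Factorial_Ring.prime p" and "n \<ge> 1" and "q = p ^ n" and "q \<ge> 3"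
    and "field F" and "finite (carrier F)" and "Coset.order F = q"
    and "\<chi> \<in> carrier (character_group (mult_of F))"
    and "generate (character_group (mult_of F)) {\<chi>} = carrier (character_group (mult_of F))"
  shows "det (mat (q - 2) (q - 2)
           (\<lambda>(i, j). jacobi_sum F (\<chi> [^]\<^bsub>character_group (mult_of F)\<^esub> (i + 1))
                                   (\<chi> [^]\<^bsub>character_group (mult_of F)\<^esub> (j + 1)))) =
         (of_nat (q - 1) :: complex) ^ (q - 3)"
proof -
  interpret F: field F by fact
  interpret M: group "mult_of F" by (rule F.field_mult_group)
  \<comment> \<open>\<open>m\<close> is both the size of the matrix and the number of field elements
    other than 0 and 1, so \<open>A\<close> below is square; \<open>N\<close> is the order of the
    multiplicative group.\<close>
  define m where "m = q - 2"
  define N where "N = q - 1"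
  have m: "m > 0" "N = Suc m" using assms(4) by (auto simp: m_def N_def)
  define S where "S = carrier F - {\<zero>\<^bsub>F\<^esub>, \<one>\<^bsub>F\<^esub>}"
  have finS: "finite S" using assms(6) by (simp add: S_def)
  have cardS: "card S = m"
    using assms(6,7) by (simp add: S_def m_def Coset.order_def card_Diff_subset)
  have eq0: "\<one>\<^bsub>F\<^esub> \<ominus>\<^bsub>F\<^esub> x = \<zero>\<^bsub>F\<^esub> \<longleftrightarrow> x = \<one>\<^bsub>F\<^esub>" if "x \<in> carrier F" for x
    using that by (metis F.one_closed F.r_right_minus_eq)
  have inv: "\<one>\<^bsub>F\<^esub> \<ominus>\<^bsub>F\<^esub> (\<one>\<^bsub>F\<^esub> \<ominus>\<^bsub>F\<^esub> x) = x" if "x \<in> carrier F" for x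
    using that by (simp add: F.minus_eq F.minus_add F.r_neg2)
  have "\<exists>e. bij_betw e {..<card S} S \<and>
      (\<forall>k < card S. e (card S - 1 - k) = \<one>\<^bsub>F\<^esub> \<ominus>\<^bsub>F\<^esub> e k)"
  proof (rule involution_symmetric_enumeration[OF finS])
    show "\<one>\<^bsub>F\<^esub> \<ominus>\<^bsub>F\<^esub> x \<in> S" if "x \<in> S" for x
      using that eq0[of x] eq0[of "\<one>\<^bsub>F\<^esub> \<ominus>\<^bsub>F\<^esub> x"] inv[of x] by (auto simp: S_def)
  qed (auto simp: S_def inv intro: F.one_minus_fixed_point_unique)
  then obtain e where e: "bij_betw e {..<m} S"
    and e_rev: "\<And>k. k < m \<Longrightarrow> e (m - 1 - k) = \<one>\<^bsub>F\<^esub> \<ominus>\<^bsub>F\<^esub> e k"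
    using cardS by auto
  define A where "A = mat m m (\<lambda>(i, k). \<chi> (e k) ^ (i + 1))"
  \<comment> \<open>Multiplying by \<open>R\<close> on the right reverses columns: on
    \<open>A\<close> this substitutes \<open>1 - x\<close> for \<open>x\<close>, on
    \<open>A * transpose_mat A\<close> it reverses the exponents of the second factor.\<close>
  define R :: "complex mat" where "R = mat m m (\<lambda>(i, j). if i = m - 1 - j then 1 else 0)"
  have carr: "A \<in> carrier_mat m m" "R \<in> carrier_mat m m" "transpose_mat A \<in> carrier_mat m m"
    by (simp_all add: A_def R_def)
  have mult_R: "(B * R) $$ (i, j) = B $$ (i, m - 1 - j)"
    if "B \<in> carrier_mat m m" "i < m" "j < m" for B :: "complex mat" and i j
  proof -
    have "(B * R) $$ (i, j) = (\<Sum>l = 0..<m. B $$ (i, l) * (if l = m - 1 - j then 1 else 0))"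
      using that by (simp add: R_def scalar_prod_def)
    also have "\<dots> = (\<Sum>l = 0..<m. if l = m - 1 - j then B $$ (i, l) else 0)"
      by (intro sum.cong) auto
    finally show ?thesis using that by simp
  qed
  have sum_S: "(\<Sum>x\<in>S. f x) = (\<Sum>k = 0..<m. f (e k))" for f :: "'a \<Rightarrow> complex"
    using sum.reindex_bij_betw[OF e, of f] by (simp add: lessThan_atLeast0)
  have \<chi>1: "\<chi> \<one>\<^bsub>F\<^esub> = 1" using character_one[OF M.group_axioms assms(8)] by simp
  have AR: "A * R = mat m m (\<lambda>(i, k). \<chi> (\<one>\<^bsub>F\<^esub> \<ominus>\<^bsub>F\<^esub> e k) ^ (i + 1))"
  proof (rule eq_matI)
    fix i k assume "i < dim_row (mat m m (\<lambda>(i, k). \<chi> (\<one>\<^bsub>F\<^esub> \<ominus>\<^bsub>F\<^esub> e k) ^ (i + 1)))"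
      and "k < dim_col (mat m m (\<lambda>(i, k). \<chi> (\<one>\<^bsub>F\<^esub> \<ominus>\<^bsub>F\<^esub> e k) ^ (i + 1)))"
    then have ik: "i < m" "k < m" by simp_all
    then show "(A * R) $$ (i, k) = mat m m (\<lambda>(i, k). \<chi> (\<one>\<^bsub>F\<^esub> \<ominus>\<^bsub>F\<^esub> e k) ^ (i + 1)) $$ (i, k)"
      unfolding mult_R[OF carr(1) ik] by (simp add: A_def e_rev[symmetric])
  qed (use carr in auto)
  have "mat m m (\<lambda>(i, j). jacobi_sum F (\<chi> [^]\<^bsub>character_group (mult_of F)\<^esub> (i + 1))
            (\<chi> [^]\<^bsub>character_group (mult_of F)\<^esub> (j + 1))) = A * transpose_mat (A * R)"
    unfolding AR F.jacobi_sum_powers[OF assms(6)] S_def[symmetric] sum_S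
    by (rule eq_matI) (auto simp: A_def scalar_prod_def)
  then have "det (mat m m (\<lambda>(i, j). jacobi_sum F (\<chi> [^]\<^bsub>character_group (mult_of F)\<^esub> (i + 1))
            (\<chi> [^]\<^bsub>character_group (mult_of F)\<^esub> (j + 1)))) = det (A * transpose_mat A * R)"
    using carr by (simp add: det_mult[of _ m] det_transpose[of _ m])
  also have "A * transpose_mat A * R = mat m m (\<lambda>(i, j). (if i = j then of_nat N else 0) - 1)"
  proof (rule eq_matI)
    fix i j
    assume "i < dim_row (mat m m (\<lambda>(i, j). (if i = j then of_nat N else 0) - 1 :: complex))"
      and "j < dim_col (mat m m (\<lambda>(i, j). (if i = j then of_nat N else 0) - 1 :: complex))"
    then have ij: "i < m" "j < m" by simp_all
    \<comment> \<open>Column \<open>m - 1 - j\<close> belongs to the exponent \<open>m - j\<close>,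
      so \<open>d = N + i - j\<close>. This lies strictly between 0 and \<open>2 * N\<close>, hence
      \<open>N\<close> divides it only when \<open>i = j\<close>.\<close>
    define d where "d = (i + 1) + (m - 1 - j + 1)"
    have "(A * transpose_mat A * R) $$ (i, j) = (A * transpose_mat A) $$ (i, m - 1 - j)"
      using ij carr by (intro mult_R) auto
    also have "\<dots> = (\<Sum>k = 0..<m. \<chi> (e k) ^ (i + 1) * \<chi> (e k) ^ (m - 1 - j + 1))"
      using ij by (simp add: A_def scalar_prod_def)
    also have "\<dots> = (\<Sum>x\<in>S. \<chi> x ^ d)"
      by (simp only: sum_S d_def power_add)
    \<comment> \<open>The term at \<open>\<one>\<close>, missing from \<open>S\<close>, equals 1; it
      produces the all-ones matrix.\<close>
    also have "\<dots> = (\<Sum>x\<in>carrier (mult_of F). \<chi> x ^ d) - 1"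
    proof -
      have "carrier (mult_of F) = insert \<one>\<^bsub>F\<^esub> S" "\<one>\<^bsub>F\<^esub> \<notin> S" by (auto simp: S_def)
      then show ?thesis using finS by (simp add: \<chi>1)
    qed
    also have "\<dots> = (if N dvd d then of_nat N else 0) - 1"
      unfolding F.sum_generator_power[OF assms(6,8,9)] assms(7) N_def ..
    also have "N dvd d \<longleftrightarrow> i = j"
    proof
      assume "N dvd d"
      then obtain c where c: "d = N * c" by blast
      have "0 < d" "d < N * 2" using ij m by (auto simp: d_def)
      then have "c = 1" using c by (cases c) auto
      then show "i = j" using c ij m by (simp add: d_def)
    qed (use ij m in \<open>simp add: d_def\<close>)
    finally show "(A * transpose_mat A * R) $$ (i, j) =
        mat m m (\<lambda>(i, j). (if i = j then of_nat N else 0) - 1) $$ (i, j)"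
      using ij by simp
  qed (use carr in auto)
  \<comment> \<open>Here \<open>c = N\<close> and the size is \<open>m = N - 1\<close>, so the
    exceptional factor \<open>c - of_nat (Suc k)\<close> is 1 and only \<open>N ^ (m - 1)\<close>
    remains.\<close>
  also have "det \<dots> = of_nat N ^ (m - 1)"
    using det_scalar_minus_ones[of "m - 1" "of_nat N :: complex"] m by simp
  finally show ?thesis by (simp add: m_def N_def numeral_3_eq_3 diff_diff_left)
qed

end
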